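(* There exists a $2$-extendible system that is not a $2$-growth system.
   Context: An independence system $(S,\mathcal{I})$ is a finite set $S$ with a nonempty downward-closed family $\mathcal{I}\subseteq2^S$ of independent sets. A basis of $X\subseteq S$ is an inclusion-wise maximal independent subset of $X$. $k$-extendible: for every $A\subseteq B\in\mathcal{I}$ and $e\in S\setminus B$ with $A\cup\{e\}\in\mathcal{I}$, there is $Z\subseteq B\setminus A$ with $|Z|\le k$ and $(B\cup\{e\})\setminus Z\in\mathcal{I}$. $k$-growth: for all $X\subseteq S$ and all $I\in\mathcal{I}$ there is a partition $(Q,Z)$ of $I\setminus X$ with $|Z|\le k|X\setminus I|$ such that $P\cup Q\in\mathcal{I}$ for every basis $P$ of $X$. *)

theory Defs
  imports Main
begin

definition independence_system :: "'a set \<Rightarrow> 'a set set \<Rightarrow> bool" where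
  "independence_system S \<I> \<longleftrightarrow>
     finite S \<and> \<I> \<subseteq> Pow S \<and> \<I> \<noteq> {} \<and> (\<forall>J\<in>\<I>. \<forall>I. I \<subseteq> J \<longrightarrow> I \<in> \<I>)"

definition basis_of :: "'a set set \<Rightarrow> 'a set \<Rightarrow> 'a set \<Rightarrow> bool" where
  "basis_of \<I> X P \<longleftrightarrow>
     P \<in> \<I> \<and> P \<subseteq> X \<and> (\<forall>P'\<in>\<I>. P \<subseteq> P' \<and> P' \<subseteq> X \<longrightarrow> P' = P)"

definition k_extendible :: "nat \<Rightarrow> 'a set \<Rightarrow> 'a set set \<Rightarrow> bool" where
  "k_extendible k S \<I> \<longleftrightarrow>
     (\<forall>A B e. A \<subseteq> B \<and> B \<in> \<I> \<and> e \<in> S - B \<and> A \<union> {e} \<in> \<I> \<longrightarrow>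
        (\<exists>Z. Z \<subseteq> B - A \<and> card Z \<le> k \<and> (B \<union> {e}) - Z \<in> \<I>))"

(* The two parts Q and Z may be empty. They are chosen before the basis P,
   so a single choice has to work for all bases of X. *)
definition k_growth :: "nat \<Rightarrow> 'a set \<Rightarrow> 'a set set \<Rightarrow> bool" where
  "k_growth k S \<I> \<longleftrightarrow>
     (\<forall>X I. X \<subseteq> S \<and> I \<in> \<I> \<longrightarrow>
        (\<exists>Q Z. Q \<union> Z = I - X \<and> Q \<inter> Z = {} \<and> card Z \<le> k * card (X - I) \<and>
           (\<forall>P. basis_of \<I> X P \<longrightarrow> P \<union> Q \<in> \<I>)))"

end

theory Submission
  imports Defs
begin

text \<open>Take an element 0 and three disjoint pairs \<open>{i, i + 3}\<close> for \<open>i = 1, 2, 3\<close>, and call a set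
  independent if it omits 0 or omits one of the pairs entirely. A conflict is always repaired by
  deleting 0 or one whole pair, which gives 2-extendibility. For \<open>X = {0, 1, 2, 3}\<close> and
  \<open>I = {1..6}\<close>, each of the bases \<open>X - {i}\<close> with \<open>i = 1, 2, 3\<close> excludes \<open>i + 3\<close> from \<open>Q\<close>,
  so \<open>Z\<close> must contain three elements, while \<open>2 * card (X - I) = 2\<close>.\<close>

definition pair_system :: "nat set set" where
  "pair_system = {T. T \<subseteq> {0..6} \<and> (0 \<in> T \<longrightarrow> (\<exists>i\<in>{1, 2, 3}. T \<inter> {i, i + 3} = {}))}"

text \<open>The index \<open>i\<close> is constrained only when \<open>0 \<in> T\<close>, so the
  rule also covers sets without 0, where any \<open>i\<close> will do.\<close>

lemma pair_systemI:
  assumes "T \<subseteq> {0..6}" "0 \<in> T \<Longrightarrow> i \<in> {1, 2, 3} \<and> i \<notin> T \<and> i + 3 \<notin> T"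
  shows "T \<in> pair_system"
  using assms unfolding pair_system_def by (cases "0 \<in> T") force+

lemma pair_systemE:
  assumes "T \<in> pair_system" "0 \<in> T"
  obtains i where "i \<in> {1, 2, 3}" "i \<notin> T" "i + 3 \<notin> T"
  using assms unfolding pair_system_def by force

lemma pair_system_subset: "T \<in> pair_system \<Longrightarrow> T \<subseteq> {0..6}"
  by (simp add: pair_system_def)

lemma independence_system_pair_system: "independence_system {0..6} pair_system"
proof -
  have "{} \<in> pair_system"
    by (simp add: pair_system_def)
  moreover have "I \<in> pair_system" if "J \<in> pair_system" "I \<subseteq> J" for I J
  proof (cases "0 \<in> I")
    case True
    with that(2) have "0 \<in> J"
      by (rule subsetD)
    with that(1) obtain i where "i \<in> {1, 2, 3}" "i \<notin> J" "i + 3 \<notin> J"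
      by (rule pair_systemE)
    moreover have "I \<subseteq> {0..6}"
      using that(2) pair_system_subset[OF that(1)] by (rule subset_trans)
    ultimately show ?thesis
      using that(2) by (intro pair_systemI[of I i] conjI) (auto dest: subsetD)
  next
    case False
    moreover have "I \<subseteq> {0..6}"
      using that(2) pair_system_subset[OF that(1)] by (rule subset_trans)
    ultimately show ?thesis
      by (simp add: pair_system_def)
  qed
  moreover have "pair_system \<subseteq> Pow {0..6}"
    using pair_system_subset by blast
  ultimately show ?thesis
    unfolding independence_system_def by blast
qed

text \<open>The set \<open>A \<union> {e}\<close> tells what may be deleted: if it contains 0, it
  misses a whole pair, and that pair can go without touching \<open>A\<close> or \<open>e\<close>;
  if it does not, 0 itself can go.\<close>

lemma k_extendible_pair_system: "k_extendible 2 {0..6} pair_system"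
  unfolding k_extendible_def
proof (intro allI impI, elim conjE)
  fix A B :: "nat set" and e :: nat
  assume "A \<subseteq> B" and B: "B \<in> pair_system" and e: "e \<in> {0..6} - B"
    and Ae: "A \<union> {e} \<in> pair_system"
  have sub: "B \<union> {e} \<subseteq> {0..6}"
    using pair_system_subset[OF B] e by simp
  show "\<exists>Z\<subseteq>B - A. card Z \<le> 2 \<and> B \<union> {e} - Z \<in> pair_system"
  proof (cases "0 \<in> A \<union> {e}")
    case True
    with Ae obtain i where i: "i \<in> {1, 2, 3}" "i \<notin> A \<union> {e}" "i + 3 \<notin> A \<union> {e}"
      by (rule pair_systemE)
    \<comment> \<open>Intersecting with \<open>B\<close> keeps the deleted set inside
      \<open>B\<close>, which may contain only part of the pair. Since \<open>e\<close> is not in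
      the pair, the result misses it entirely.\<close>
    have "card (B \<inter> {i, i + 3}) \<le> card {i, i + 3}"
      by (intro card_mono) auto
    then have "card (B \<inter> {i, i + 3}) \<le> 2"
      by simp
    moreover have "B \<inter> {i, i + 3} \<subseteq> B - A"
      using i(2,3) by auto
    moreover have "B \<union> {e} - B \<inter> {i, i + 3} \<in> pair_system"
    proof (rule pair_systemI)
      show "B \<union> {e} - B \<inter> {i, i + 3} \<subseteq> {0..6}"
        using sub by (rule order_trans[OF Diff_subset])
      show "i \<in> {1, 2, 3} \<and> i \<notin> B \<union> {e} - B \<inter> {i, i + 3} \<and> i + 3 \<notin> B \<union> {e} - B \<inter> {i, i + 3}"
        using i by simp
    qed
    ultimately show ?thesis
      by blast
  next
    case False
    \<comment> \<open>Here 0 is neither in \<open>A\<close> nor equal to \<open>e\<close>; the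
      deleted set is empty if \<open>B\<close> already omits 0.\<close>
    have "card (B \<inter> {0}) \<le> card {0::nat}"
      by (intro card_mono) auto
    then have "card (B \<inter> {0}) \<le> 2"
      by simp
    moreover have "B \<inter> {0} \<subseteq> B - A"
      using False by blast
    moreover have "B \<union> {e} - B \<inter> {0} \<in> pair_system"
      using False sub by (intro pair_systemI) auto
    ultimately show ?thesis
      by blast
  qed
qed

text \<open>Without \<open>i\<close> the set misses the pair of \<open>i\<close>, as
  \<open>i + 3\<close> exceeds 3. Only the full set lies strictly above it, and that one contains 0
  and meets every pair.\<close>

lemma basis_of_pair_system:
  assumes "i \<in> {1, 2, 3}"
  shows "basis_of pair_system {0, 1, 2, 3} ({0, 1, 2, 3} - {i})"
proof -
  have "{0, 1, 2, 3} - {i} \<in> pair_system"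
    using assms by (auto simp: pair_system_def)
  moreover have "{0, 1, 2, 3} \<notin> pair_system"
    by (auto simp: pair_system_def)
  moreover have "P = {0, 1, 2, 3} - {i} \<or> P = {0, 1, 2, 3}"
    if "{0, 1, 2, 3} - {i} \<subseteq> P" "P \<subseteq> {0, 1, 2, 3}" for P
  proof (cases "i \<in> P")
    case True
    then have "{0, 1, 2, 3} \<subseteq> P"
      using that(1) by blast
    then show ?thesis
      using that(2) by (intro disjI2 equalityI)
  next
    case False
    then have "P \<subseteq> {0, 1, 2, 3} - {i}"
      using that(2) by blast
    then show ?thesis
      using that(1) by (intro disjI1 equalityI)
  qed
  ultimately show ?thesis
    unfolding basis_of_def by (intro conjI ballI impI Diff_subset) metis+
qed

lemma not_k_growth_pair_system: "\<not> k_growth 2 {0..6} pair_system"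
proof
  let ?X = "{0, 1, 2, 3} :: nat set" and ?I = "{1..6} :: nat set"
  assume "k_growth 2 {0..6} pair_system"
  moreover have "?X \<subseteq> {0..6}" "?I \<in> pair_system"
    by (auto simp: pair_system_def)
  ultimately obtain Q Z where QZ: "Q \<union> Z = ?I - ?X" and Z: "card Z \<le> 2 * card (?X - ?I)"
    and Q: "\<And>P. basis_of pair_system ?X P \<Longrightarrow> P \<union> Q \<in> pair_system"
    unfolding k_growth_def by metis
  \<comment> \<open>\<open>Q\<close> is fixed before the basis, so all three bases restrict the same
    \<open>Q\<close>.\<close>
  have notQ: "i + 3 \<notin> Q" if i: "i \<in> {1, 2, 3}" for i
  proof
    assume "i + 3 \<in> Q"
    have "?X - {i} \<union> Q \<in> pair_system"
      by (rule Q[OF basis_of_pair_system[OF i]])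
    moreover have "0 \<in> ?X - {i} \<union> Q"
      using i by auto
    ultimately obtain j where j: "j \<in> {1, 2, 3}" "j \<notin> ?X - {i} \<union> Q" "j + 3 \<notin> ?X - {i} \<union> Q"
      by (rule pair_systemE)
    \<comment> \<open>Any other index in \<open>{1, 2, 3}\<close> still lies in the basis
      \<open>?X - {i}\<close>, so only the pair of \<open>i\<close> can be missed.\<close>
    then have "j = i"
      by auto
    with j(3) \<open>i + 3 \<in> Q\<close> show False
      by simp
  qed
  have IX: "?I - ?X = {4, 5, 6}" and XI: "?X - ?I = {0}"
    by auto
  have "4 \<notin> Q" "5 \<notin> Q" "6 \<notin> Q"
    using notQ[of 1] notQ[of 2] notQ[of 3] by simp_all
  \<comment> \<open>Nothing is left for \<open>Q\<close>, so \<open>Z\<close> has 3 elements against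
    the bound 2 * 1.\<close>
  then have "Z = {4, 5, 6}"
    using QZ unfolding IX by blast
  then show False
    using Z unfolding XI by simp
qed

theorem theorem11:
  "\<exists>(S :: nat set) \<I>. independence_system S \<I> \<and> k_extendible 2 S \<I> \<and> \<not> k_growth 2 S \<I>"
  using independence_system_pair_system k_extendible_pair_system not_k_growth_pair_system
  by blast

end
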